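(* Let $V$ be an $\mathbb{N}$-graded Möbius vertex algebra and let $N$ be a positive integer. Let $X\subset V$ be a set of homogeneous representatives of a spanning set for the quotient space $V/C_{N+1}(V)$ (that is, $X$ consists of homogeneous elements of $V$ whose images in $V/C_{N+1}(V)$ span $V/C_{N+1}(V)$). Then $V$ is spanned by the elements of the form $$x^1_{n_1}x^2_{n_2}\cdots x^k_{n_k}\mathbf{1},$$ where $k\in\mathbb{N}$; $x^1,\ldots,x^k\in X$; $n_1,\ldots,n_k$ are negative integers; $n_1<n_2<\cdots<n_k<0$; and $n_{i+1}-n_i\ge N$ for each $1\le i\le k-1$. (For $k=0$ the element is $\mathbf{1}$.)
   Context: $\mathbb{N}=\{0,1,2,\dots\}$. Vector spaces are over a field of characteristic $0$ (e.g. $\mathbb{C}$). A Möbius vertex algebra is a $\mathbb{Z}$-graded vector space $V=\coprod_{n\in\mathbb{Z}}V_n$ with a linear map $Y:V\to \mathrm{End}(V)[[x,x^{-1}]]$, $v\mapsto Y(v,x)=\sum_{n\in\mathbb{Z}}v_nx^{-n-1}$ ($v_n\in\mathrm{End}(V)$ are the modes of $v$), and a distinguished vector $\mathbf{1}\in V_0$, such that for all $u,v\in V$: (1) $u_nv=0$ for $n$ sufficiently large; (2) $Y(\mathbf{1},x)=1_V$; (3) $Y(v,x)\mathbf{1}\in V[[x]]$ and $\lim_{x\to0}Y(v,x)\mathbf{1}=v$; (4) the Jacobi identity $$x_0^{-1}\delta\!\left(\tfrac{x_1-x_2}{x_0}\right)Y(u,x_1)Y(v,x_2)-x_0^{-1}\delta\!\left(\tfrac{x_2-x_1}{-x_0}\right)Y(v,x_2)Y(u,x_1)=x_2^{-1}\delta\!\left(\tfrac{x_1-x_0}{x_2}\right)Y(Y(u,x_0)v,x_2),$$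 where $\delta(x)=\sum_{n\in\mathbb{Z}}x^n$ and binomial expressions are expanded in nonnegative powers of the second variable; (5) there is a representation $\rho$ of $\mathfrak{sl}(2)$ on $V$, with $L(j)=\rho(L_j)$ for $j=-1,0,1$, where $L_{-1},L_0,L_1$ is a basis of $\mathfrak{sl}(2)$ with $[L_0,L_{-1}]=L_{-1}$, $[L_0,L_1]=-L_1$, $[L_{-1},L_1]=-2L_0$, such that for $j=-1,0,1$: $[L(j),Y(u,x)]=\sum_{k=0}^{j+1}\binom{j+1}{k}x^{j+1-k}Y(L(k-1)u,x)$; $\frac{d}{dx}Y(v,x)=Y(L(-1)v,x)$; and $L(0)v=nv=(\mathrm{wt}\,v)v$ for $v\in V_n$. $V$ is $\mathbb{N}$-graded if $V_n=0$ for $n<0$. An element is homogeneous if it lies in some $V_n$. For a positive integer $M$, the $M$-th Zhu subspace $C_M(V)$ is the linear span of $\{u_{-M}v: u,v\in V\}$. *)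

theory Defs
  imports Complex_Main "HOL-Library.Groups_Big_Fun"
begin

text \<open>
  Formal Laurent series in \<open>x\<^sub>0, x\<^sub>1, x\<^sub>2\<close>, infinite in both directions, are represented by
  their coefficient functions: \<open>F a b c\<close> is the coefficient of \<open>x\<^sub>0^a x\<^sub>1^b x\<^sub>2^c\<close>.
\<close>

type_synonym 'a series3 = "int \<Rightarrow> int \<Rightarrow> int \<Rightarrow> 'a"

text \<open>The coefficient of \<open>y^i z^j\<close> in \<open>(y - z)^n\<close>, expanded in nonnegative powers of \<open>z\<close>.\<close>

definition binom_minus :: "int \<Rightarrow> int \<Rightarrow> int \<Rightarrow> 'k::field_char_0" where
  "binom_minus n i j =
     (if 0 \<le> j \<and> i + j = n then (- 1) ^ nat j * (of_int n gchoose nat j) else 0)"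

text \<open>
  The three delta functions of the Jacobi identity, with \<open>\<delta>(x) = (\<Sum>n\<in>\<int>. x^n)\<close>:
  \<^item> \<open>x\<^sub>0^(-1) \<delta>((x\<^sub>1 - x\<^sub>2) / x\<^sub>0) = (\<Sum>n\<in>\<int>. x\<^sub>0^(-n-1) (x\<^sub>1 - x\<^sub>2)^n)\<close>
  \<^item> \<open>x\<^sub>0^(-1) \<delta>((x\<^sub>2 - x\<^sub>1) / (-x\<^sub>0)) = (\<Sum>n\<in>\<int>. (-1)^n x\<^sub>0^(-n-1) (x\<^sub>2 - x\<^sub>1)^n)\<close>
  \<^item> \<open>x\<^sub>2^(-1) \<delta>((x\<^sub>1 - x\<^sub>0) / x\<^sub>2) = (\<Sum>n\<in>\<int>. x\<^sub>2^(-n-1) (x\<^sub>1 - x\<^sub>0)^n)\<close>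
\<close>

definition delta_12_0 :: "'k::field_char_0 series3" where
  "delta_12_0 a b c = binom_minus (- a - 1) b c"

definition delta_21_0 :: "'k::field_char_0 series3" where
  "delta_21_0 a b c = (- 1) powi (- a - 1) * binom_minus (- a - 1) c b"

definition delta_10_2 :: "'k::field_char_0 series3" where
  "delta_10_2 a b c = binom_minus (- c - 1) b a"

text \<open>
  Product of a scalar series and a vector-valued series. \<open>Sum_any\<close> is the sum over the support,
  so this is meaningful when each coefficient is a sum with finitely many nonzero terms; by the
  truncation condition on modes this holds for the three products in the Jacobi identity.
\<close>

definition series3_mult ::
  "('k \<Rightarrow> 'v \<Rightarrow> 'v) \<Rightarrow> 'k::field_char_0 series3 \<Rightarrow> 'v::ab_group_add series3 \<Rightarrow> 'v series3" where
  "series3_mult scale D F a b c =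
     Sum_any (\<lambda>(p, q, r). scale (D (a - p) (b - q) (c - r)) (F p q r))"

text \<open>
  \<open>Y v n\<close> is the mode \<open>v\<^sub>n\<close>, i.e. the coefficient of \<open>x^(-n-1)\<close> in \<open>Y(v,x)\<close>. The next three series
  are \<open>Y(u,x\<^sub>1) Y(v,x\<^sub>2) w\<close>, \<open>Y(v,x\<^sub>2) Y(u,x\<^sub>1) w\<close> and \<open>Y(Y(u,x\<^sub>0)v,x\<^sub>2) w\<close>.
\<close>

definition Y_prod :: "('v \<Rightarrow> int \<Rightarrow> 'v \<Rightarrow> 'v) \<Rightarrow> 'v \<Rightarrow> 'v \<Rightarrow> 'v \<Rightarrow> 'v::zero series3" where
  "Y_prod Y u v w a b c = (if a = 0 then Y u (- b - 1) (Y v (- c - 1) w) else 0)"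

definition Y_prod_opp :: "('v \<Rightarrow> int \<Rightarrow> 'v \<Rightarrow> 'v) \<Rightarrow> 'v \<Rightarrow> 'v \<Rightarrow> 'v \<Rightarrow> 'v::zero series3" where
  "Y_prod_opp Y u v w a b c = (if a = 0 then Y v (- c - 1) (Y u (- b - 1) w) else 0)"

definition Y_iter :: "('v \<Rightarrow> int \<Rightarrow> 'v \<Rightarrow> 'v) \<Rightarrow> 'v \<Rightarrow> 'v \<Rightarrow> 'v \<Rightarrow> 'v::zero series3" where
  "Y_iter Y u v w a b c = (if b = 0 then Y (Y u (- a - 1) v) (- c - 1) w else 0)"

text \<open>
  The representation of \<open>sl(2)\<close> is given by the images \<open>L j\<close> of the basis elements \<open>L\<^sub>j\<close>,
  \<open>j \<in> {-1,0,1}\<close>; the values of \<open>L\<close> at other integers are irrelevant. Identities between series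
  in one variable are stated for the coefficients of \<open>x^(-n-1)\<close>.
\<close>

locale moebius_vertex_algebra = vector_space scale
  for scale :: "'k::field_char_0 \<Rightarrow> 'v::ab_group_add \<Rightarrow> 'v" +
  fixes V :: "int \<Rightarrow> 'v set"
    and Y :: "'v \<Rightarrow> int \<Rightarrow> 'v \<Rightarrow> 'v"
    and vac :: 'v
    and L :: "int \<Rightarrow> 'v \<Rightarrow> 'v"
  assumes grading_subspace: "subspace (V n)"
    and grading_direct_sum:
      "\<exists>!f. finite {n. f n \<noteq> 0} \<and> (\<forall>n. f n \<in> V n) \<and> v = (\<Sum>n | f n \<noteq> 0. f n)"
    and Y_linear: "Vector_Spaces.linear scale scale (\<lambda>u. Y u n w)"
    and mode_linear: "Vector_Spaces.linear scale scale (Y u n)"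
    and vac_degree: "vac \<in> V 0"
    and truncation: "\<exists>m. \<forall>n\<ge>m. Y u n v = 0"
    and vacuum: "Y vac n v = (if n = - 1 then v else 0)"
    and creation_regular: "0 \<le> n \<Longrightarrow> Y v n vac = 0"
    and creation_limit: "Y v (- 1) vac = v"
    and jacobi:
      "series3_mult scale delta_12_0 (Y_prod Y u v w) a b c
         - series3_mult scale delta_21_0 (Y_prod_opp Y u v w) a b c
       = series3_mult scale delta_10_2 (Y_iter Y u v w) a b c"
    and L_linear: "j \<in> {- 1, 0, 1} \<Longrightarrow> Vector_Spaces.linear scale scale (L j)"
    and bracket_L0_Lm1: "L 0 (L (- 1) v) - L (- 1) (L 0 v) = L (- 1) v"
    and bracket_L0_L1: "L 0 (L 1 v) - L 1 (L 0 v) = - L 1 v"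
    and bracket_Lm1_L1: "L (- 1) (L 1 v) - L 1 (L (- 1) v) = scale (- 2) (L 0 v)"
    and L_Y_commutator:
      "j \<in> {- 1, 0, 1} \<Longrightarrow>
         L j (Y u n w) - Y u n (L j w)
         = (\<Sum>k = 0..nat (j + 1).
              scale (of_nat (nat (j + 1) choose k)) (Y (L (int k - 1) u) (n + j + 1 - int k) w))"
    and L_derivative: "scale (of_int (- n)) (Y v (n - 1) w) = Y (L (- 1) v) n w"
    and L0_weight: "v \<in> V n \<Longrightarrow> L 0 v = scale (of_int n) v"

definition N_graded :: "(int \<Rightarrow> 'v::zero set) \<Rightarrow> bool" where
  "N_graded V \<longleftrightarrow> (\<forall>n<0. V n = {0})"

definition homogeneous :: "(int \<Rightarrow> 'v set) \<Rightarrow> 'v \<Rightarrow> bool" where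
  "homogeneous V v \<longleftrightarrow> (\<exists>n. v \<in> V n)"

definition coset_rel :: "'v::ab_group_add set \<Rightarrow> ('v \<times> 'v) set" where
  "coset_rel W = {(v, w). v - w \<in> W}"

context vector_space
begin

definition zhu_subspace :: "('b \<Rightarrow> int \<Rightarrow> 'b \<Rightarrow> 'b) \<Rightarrow> nat \<Rightarrow> 'b set" where
  "zhu_subspace Y M = span {Y u (- int M) v | u v. True}"

text \<open>
  A linear combination of cosets is the coset of the linear combination of representatives, so
  the left-hand side is the span of the images of \<open>X\<close> in the quotient by \<open>W\<close>.
\<close>

definition spans_quotient :: "'b set \<Rightarrow> 'b set \<Rightarrow> bool" where
  "spans_quotient X W \<longleftrightarrow> (\<lambda>v. coset_rel W `` {v}) ` span X = UNIV // coset_rel W"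

end

text \<open>The element \<open>x\<^sup>1\<^sub>n\<^sub>1 \<dots> x\<^sup>k\<^sub>n\<^sub>k vac\<close> for the list \<open>[(x\<^sup>1, n\<^sub>1), \<dots>, (x\<^sup>k, n\<^sub>k)]\<close>.\<close>

definition mode_word :: "('v \<Rightarrow> int \<Rightarrow> 'v \<Rightarrow> 'v) \<Rightarrow> 'v \<Rightarrow> ('v \<times> int) list \<Rightarrow> 'v" where
  "mode_word Y vac ps = foldr (\<lambda>(x, n). Y x n) ps vac"

definition admissible :: "nat \<Rightarrow> 'v set \<Rightarrow> ('v \<times> int) list \<Rightarrow> bool" where
  "admissible N X ps \<longleftrightarrow>
     (\<forall>(x, n) \<in> set ps. x \<in> X \<and> n < 0) \<and>
     sorted_wrt (<) (map snd ps) \<and>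
     (\<forall>i. Suc i < length ps \<longrightarrow> snd (ps ! Suc i) - snd (ps ! i) \<ge> int N)"

end

theory Submission
  imports Defs "HOL-Library.Multiset"
begin

text \<open>
  A word is an element \<open>u\<^sub>1(n\<^sub>1) \<dots> u\<^sub>k(n\<^sub>k) vac\<close> with homogeneous letters \<open>u\<^sub>i\<close>. The proof rests on one
  choice: a letter of weight \<open>w\<close> costs \<open>2 w + 2 N - 1\<close>, and a word costs the sum over its letters.
  Costs are natural numbers because the algebra is graded by the naturals, and modulo words of
  smaller cost four simplifications hold.
    \<^item> Letters commute: a commutator merges two letters into one whose weight is smaller than the
      sum of the two weights (\<open>commutator_below\<close>).
    \<^item> A nonnegative mode gives zero, because it can be moved to the right until it meets the vacuum
      (\<open>nonnegative_mode_below\<close>).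
    \<^item> A letter \<open>p\<^sub>-\<^sub>N\<^sub>-\<^sub>1 q\<close> gives zero: it has weight \<open>wt p + wt q + N\<close>, and the iterate formula
      replaces it by two letters of total weight \<open>wt p + wt q\<close>. This changes the cost by
      \<open>- 2 N + (2 N - 1) = - 1\<close> (\<open>zhu_letter_below\<close>). Hence letters from \<open>X\<close> suffice.
    \<^item> Modes of \<open>u\<^sub>-\<^sub>1\<^sub>-\<^sub>j v\<close> give zero in the cost of the pair \<open>u\<close>, \<open>v\<close> when \<open>j < N\<close>, because
      merging the letters changes the cost by \<open>2 j - (2 N - 1) < 0\<close> (\<open>iterate_relation\<close>).
  
  The two weight changes go in opposite directions; the constant \<open>2 N - 1\<close> per letter lies strictly
  between the thresholds \<open>2 (N - 1)\<close> and \<open>2 N\<close>, so both decrease the cost.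
  
  By the last item, for each fixed sum \<open>s\<close> of two modes,
  \<open>(\<Sum>a + b = s, a < 0, b < 0. P(a) u\<^sub>a v\<^sub>b)\<close> vanishes modulo smaller cost for every polynomial \<open>P\<close> of
  degree less than \<open>N\<close>. At most \<open>N\<close> of these pairs satisfy \<open>\<bar>a - b\<bar> < N\<close>, so choosing \<open>P\<close> to be \<open>1\<close> at
  one of them and \<open>0\<close> at the others expresses this pair through pairs with
  \<open>\<bar>a - b\<bar> \<ge> N\<close> (\<open>close_pair_in_subspace\<close>). Such a replacement keeps the sum of the modes and increases
  the sum of their squares, which is at most the square of the sum while all modes are negative.
  So the rewriting ends (\<open>X_word_in_gap_span\<close>), and it ends at words in which any two neighbours in
  the sorted order differ by at least \<open>N\<close>. An induction on the cost completes the proof.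
\<close>

section \<open>Sums, interpolation and squares\<close>

lemma Sum_any_along_injection:
  assumes "inj h" and "\<And>t. t \<notin> h ` {..<K} \<Longrightarrow> g t = 0"
  shows "Sum_any g = (\<Sum>j<K::nat. g (h j))"
proof -
  have "Sum_any g = sum g (h ` {..<K})"
    using assms(2) by (intro Sum_any.expand_superset) auto
  also have "\<dots> = (\<Sum>j<K. g (h j))"
    using assms(1) by (subst sum.reindex) (auto intro: inj_on_subset)
  finally show ?thesis .
qed

text \<open>
  The induction step is the identity \<open>(t - r) (t choose j) = (j + 1) (t choose j + 1) + (j - r) (t choose j)\<close>.
  The binomials are the right basis here, since they are the coefficients in the iterate formula.
\<close>

lemma prod_linear_in_binomial_basis:
  fixes R :: "nat set"
  assumes "finite R"
  shows "\<exists>c::nat \<Rightarrow> 'k::field_char_0. \<forall>t::nat.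
    (\<Prod>r\<in>R. of_nat t - of_nat r) = (\<Sum>j\<le>card R. c j * of_nat (t choose j))"
  using assms
proof (induction R rule: finite_induct)
  case empty
  show ?case by (intro exI[of _ "\<lambda>_. 1"]) auto
next
  case (insert r R)
  then obtain c :: "nat \<Rightarrow> 'k" where
    c: "\<And>t::nat. (\<Prod>r\<in>R. of_nat t - of_nat r) = (\<Sum>j\<le>card R. c j * of_nat (t choose j))"
    by blast
  define m where "m = card R"
  define d where "d j = (if j \<le> m then (of_nat j - of_nat r) * c j else 0)
     + (if j = 0 then 0 else of_nat j * c (j - 1))" for j
  have step: "(of_nat t - of_nat r) * of_nat (t choose j)
     = of_nat (Suc j) * of_nat (t choose Suc j) + (of_nat j - of_nat r) * (of_nat (t choose j) :: 'k)"
    for t j :: nat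
  proof -
    have "Suc j * (t choose Suc j) = (t - j) * (t choose j)"
      using binomial_absorption[of j t] binomial_absorb_comp[of t j] by (simp only:)
    hence "of_nat (Suc j) * of_nat (t choose Suc j) = (of_nat ((t - j) * (t choose j)) :: 'k)"
      by (metis of_nat_mult)
    also have "\<dots> = (of_nat t - of_nat j) * of_nat (t choose j)"
      by (cases "j \<le> t") (auto simp: of_nat_diff)
    finally show ?thesis by (simp add: algebra_simps)
  qed
  have "(\<Prod>x\<in>insert r R. of_nat t - of_nat x)
      = (\<Sum>j\<le>Suc m. d j * (of_nat (t choose j) :: 'k))" for t :: nat
  proof -
    have "(\<Prod>x\<in>insert r R. of_nat t - of_nat x)
       = (\<Sum>j\<le>m. c j * ((of_nat t - of_nat r) * (of_nat (t choose j) :: 'k)))"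
      using insert.hyps by (simp add: c m_def sum_distrib_left mult_ac)
    also have "\<dots> = (\<Sum>j\<le>m. (of_nat j - of_nat r) * c j * of_nat (t choose j))
         + (\<Sum>j\<le>m. of_nat (Suc j) * c j * of_nat (t choose Suc j))"
      unfolding step sum.distrib[symmetric] by (rule sum.cong) (simp_all add: algebra_simps)
    also have "(\<Sum>j\<le>m. (of_nat j - of_nat r) * c j * of_nat (t choose j))
       = (\<Sum>j\<le>Suc m. (if j \<le> m then (of_nat j - of_nat r) * c j else 0) * of_nat (t choose j))"
      by simp
    also have "(\<Sum>j\<le>m. of_nat (Suc j) * c j * of_nat (t choose Suc j))
       = (\<Sum>j\<le>Suc m. (if j = 0 then 0 else of_nat j * c (j - 1)) * of_nat (t choose j))"
      by (subst sum.atMost_Suc_shift) simp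
    finally show ?thesis by (simp only: d_def distrib_right sum.distrib)
  qed
  thus ?case using insert.hyps by (auto simp: m_def simp del: sum.atMost_Suc)
qed

text \<open>
  Lagrange interpolation: the normalised product of \<open>t - r\<close> over the other nodes has degree less
  than \<open>N\<close>.
\<close>

lemma binomial_interpolation:
  fixes T :: "nat set"
  assumes "finite T" "card T \<le> N" "t0 \<in> T"
  shows "\<exists>c::nat \<Rightarrow> 'k::field_char_0. \<forall>t\<in>T.
    (\<Sum>j<N. c j * of_nat (t choose j)) = (if t = t0 then 1 else 0)"
proof -
  let ?R = "T - {t0}"
  have card: "card ?R < N" and fin: "finite ?R"
    using assms card_Diff1_less[of T t0] by auto
  obtain c :: "nat \<Rightarrow> 'k" where
    c: "\<And>t::nat. (\<Prod>r\<in>?R. of_nat t - of_nat r) = (\<Sum>j\<le>card ?R. c j * of_nat (t choose j))"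
    using prod_linear_in_binomial_basis[OF fin] by blast
  define p where "p t = (\<Prod>r\<in>?R. of_nat t - of_nat r :: 'k)" for t
  define c' where "c' j = (if j \<le> card ?R then c j else 0) / p t0" for j
  have nz: "p t0 \<noteq> 0" using fin by (auto simp: p_def)
  have "(\<Sum>j<N. c' j * of_nat (t choose j)) = p t / p t0" for t
  proof -
    have "p t = (\<Sum>j<N. (if j \<le> card ?R then c j else 0) * of_nat (t choose j))"
      unfolding p_def c using card by (intro sum.mono_neutral_cong_left) auto
    thus ?thesis by (simp add: c'_def sum_divide_distrib)
  qed
  moreover have "p t = 0" if "t \<in> T" "t \<noteq> t0" for t
    unfolding p_def using that fin by (auto intro!: prod_zero)
  ultimately show ?thesis using nz by (intro exI[of _ c']) auto
qed

text \<open>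
  With \<open>b = s - a\<close> one has \<open>2 a - s = a - b\<close>, so this counts the pairs of modes with sum \<open>s\<close> that violate
  the gap condition. The differences \<open>a - b\<close> share the parity of \<open>s\<close>, and at most \<open>N\<close> of the
  \<open>2 N - 1\<close> integers in the open interval from \<open>- N\<close> to \<open>N\<close> have a given parity.
\<close>

lemma card_close_pairs:
  "card {a::int. s < a \<and> a < 0 \<and> \<bar>2 * a - s\<bar> < int N} \<le> N"
proof -
  let ?A = "{(s - int N) div 2 + 1 .. (s + int N - 1) div 2}"
  have "{a::int. s < a \<and> a < 0 \<and> \<bar>2 * a - s\<bar> < int N} \<subseteq> ?A" by auto
  hence "card {a::int. s < a \<and> a < 0 \<and> \<bar>2 * a - s\<bar> < int N} \<le> card ?A"
    by (intro card_mono) auto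
  also have "\<dots> \<le> N" by auto
  finally show ?thesis .
qed

text \<open>
  This bounds the quantity that grows when two close modes are spread apart.
\<close>

lemma sum_list_squares_le:
  fixes ns :: "int list"
  assumes "\<forall>n\<in>set ns. n < 0"
  shows "(\<Sum>n\<leftarrow>ns. n * n) \<le> sum_list ns * sum_list ns"
  using assms
proof (induction ns)
  case (Cons n ns)
  have "sum_list ns \<le> 0" using Cons.prems by (intro sum_list_nonpos) auto
  hence "0 \<le> n * sum_list ns" using Cons.prems by (simp add: mult_nonpos_nonpos)
  thus ?case using Cons by (simp add: algebra_simps)
qed simp

section \<open>The Borcherds identity\<close>

context moebius_vertex_algebra
begin

lemma Y_add_left: "Y (u + u') n w = Y u n w + Y u' n w"
  and Y_scale_left: "Y (scale c u) n w = scale c (Y u n w)"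
  using Y_linear[of n w] by (auto simp: Vector_Spaces.linear_iff)

lemma Y_add_right: "Y u n (w + w') = Y u n w + Y u n w'"
  and Y_scale_right: "Y u n (scale c w) = scale c (Y u n w)"
  using mode_linear[of u n] by (auto simp: Vector_Spaces.linear_iff)

lemma Y_zero_left [simp]: "Y 0 n w = 0"
  using Y_scale_left[of 0 0] by simp

lemma Y_zero_right [simp]: "Y u n 0 = 0"
  using Y_scale_right[of u n 0 0] by simp

lemma Y_diff_right: "Y u n (w - w') = Y u n w - Y u n w'"
  using Y_add_right[of u n "w - w'" w'] by simp

lemma subspace_Collect_Y_left: "subspace T \<Longrightarrow> subspace {u. Y u n w \<in> T}"
  by (auto simp: subspace_def Y_add_left Y_scale_left)

lemma subspace_Collect_Y_right: "subspace T \<Longrightarrow> subspace {w. Y u n w \<in> T}"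
  by (auto simp: subspace_def Y_add_right Y_scale_right)

lemma common_truncation: "\<exists>K. \<forall>j\<ge>K. Y u (m + int j) v = 0"
proof -
  obtain M where M: "\<forall>n\<ge>M. Y u n v = 0" using truncation by blast
  show ?thesis
    by (rule exI[of _ "nat (M - m)"]) (auto intro!: M[rule_format])
qed

text \<open>
  This is the Jacobi identity at the coefficient of \<open>x\<^sub>0^(-l-1) x\<^sub>1^(-m-1) x\<^sub>2^(-n-1)\<close>. Each of its three series
  products has only one free summation index there, and truncation of modes makes the sums finite.
  The cutoff is arbitrary beyond a bound, so that it can be adapted later.
\<close>

lemma borcherds:
  "\<exists>K0. \<forall>K\<ge>K0. (\<Sum>j<K. scale ((-1) ^ j * (of_int l gchoose j)) (Y u (l + m - int j) (Y v (n + int j) w)))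
    - (\<Sum>j<K. scale ((-1) powi l * ((-1) ^ j * (of_int l gchoose j)))
          (Y v (l + n - int j) (Y u (m + int j) w)))
    = (\<Sum>i<K. scale (of_int m gchoose i) (Y (Y u (l + int i) v) (m + n - int i) w))"
  (is "\<exists>K0. \<forall>K\<ge>K0. ?E K")
proof -
  obtain K1 where K1: "\<forall>j\<ge>K1. Y v (n + int j) w = 0" using common_truncation by blast
  obtain K2 where K2: "\<forall>j\<ge>K2. Y u (m + int j) w = 0" using common_truncation by blast
  obtain K3 where K3: "\<forall>j\<ge>K3. Y u (l + int j) v = 0" using common_truncation by blast
  have "?E K" if K_large: "K \<ge> max K1 (max K2 K3)" for K
  proof -
    let ?a = "- l - 1" and ?b = "- m - 1" and ?c = "- n - 1"
    have K: "Y v (n + int j) w = 0" "Y u (m + int j) w = 0" "Y u (l + int j) v = 0" if "K \<le> j" for j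
      using that K_large K1 K2 K3 by auto
    have 1: "series3_mult scale delta_12_0 (Y_prod Y u v w) ?a ?b ?c
      = (\<Sum>j<K. scale ((-1) ^ j * (of_int l gchoose j)) (Y u (l + m - int j) (Y v (n + int j) w)))"
    proof -
      let ?h = "\<lambda>j. (0, ?b - l + int j, ?c - int j)"
      let ?g = "\<lambda>(p, q, r). scale (delta_12_0 (?a - p) (?b - q) (?c - r)) (Y_prod Y u v w p q r)"
      have "Sum_any ?g = (\<Sum>j<K. ?g (?h j))"
      proof (rule Sum_any_along_injection)
        show "?g t = 0" if t: "t \<notin> ?h ` {..<K}" for t
        proof (rule ccontr)
          obtain p q r where pqr: "t = (p, q, r)" by (cases t)
          assume nz: "?g t \<noteq> 0"
          hence d: "delta_12_0 (?a - p) (?b - q) (?c - r) \<noteq> (0::'k)" and Yp: "Y_prod Y u v w p q r \<noteq> 0"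
            using pqr by auto
          define j where "j = nat (?c - r)"
          have p: "p = 0" using Yp by (auto simp: Y_prod_def split: if_splits)
          have r: "r = ?c - int j" and q: "q = ?b - l + int j"
            using d p by (auto simp: delta_12_0_def binom_minus_def j_def split: if_splits)
          have "j < K"
          proof (rule ccontr)
            assume "\<not> j < K"
            hence "Y v (n + int j) w = 0" using K by auto
            thus False using Yp p r by (auto simp: Y_prod_def algebra_simps)
          qed
          thus False using t p q r pqr by auto
        qed
      qed (auto simp: inj_def)
      also have "\<dots> = (\<Sum>j<K. scale ((-1) ^ j * (of_int l gchoose j)) (Y u (l + m - int j) (Y v (n + int j) w)))"
        by (rule sum.cong[OF refl])
           (simp add: delta_12_0_def binom_minus_def Y_prod_def algebra_simps)
      finally show ?thesis unfolding series3_mult_def .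
    qed
    have 2: "series3_mult scale delta_21_0 (Y_prod_opp Y u v w) ?a ?b ?c
      = (\<Sum>j<K. scale ((-1) powi l * ((-1) ^ j * (of_int l gchoose j)))
            (Y v (l + n - int j) (Y u (m + int j) w)))"
    proof -
      let ?h = "\<lambda>j. (0, ?b - int j, ?c - l + int j)"
      let ?g = "\<lambda>(p, q, r). scale (delta_21_0 (?a - p) (?b - q) (?c - r)) (Y_prod_opp Y u v w p q r)"
      have "Sum_any ?g = (\<Sum>j<K. ?g (?h j))"
      proof (rule Sum_any_along_injection)
        show "?g t = 0" if t: "t \<notin> ?h ` {..<K}" for t
        proof (rule ccontr)
          obtain p q r where pqr: "t = (p, q, r)" by (cases t)
          assume nz: "?g t \<noteq> 0"
          hence d: "delta_21_0 (?a - p) (?b - q) (?c - r) \<noteq> (0::'k)" and Yp: "Y_prod_opp Y u v w p q r \<noteq> 0"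
            using pqr by auto
          define j where "j = nat (?b - q)"
          have p: "p = 0" using Yp by (auto simp: Y_prod_opp_def split: if_splits)
          have r: "r = ?c - l + int j" and q: "q = ?b - int j"
            using d p by (auto simp: delta_21_0_def binom_minus_def j_def split: if_splits)
          have "j < K"
          proof (rule ccontr)
            assume "\<not> j < K"
            hence "Y u (m + int j) w = 0" using K by auto
            thus False using Yp p q by (auto simp: Y_prod_opp_def algebra_simps)
          qed
          thus False using t p q r pqr by auto
        qed
      qed (auto simp: inj_def)
      also have "\<dots> = (\<Sum>j<K. scale ((-1) powi l * ((-1) ^ j * (of_int l gchoose j)))
            (Y v (l + n - int j) (Y u (m + int j) w)))"
        by (rule sum.cong[OF refl])
           (simp add: delta_21_0_def binom_minus_def Y_prod_opp_def algebra_simps)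
      finally show ?thesis unfolding series3_mult_def .
    qed
    have 3: "series3_mult scale delta_10_2 (Y_iter Y u v w) ?a ?b ?c
      = (\<Sum>i<K. scale (of_int m gchoose i) (Y (Y u (l + int i) v) (m + n - int i) w))"
    proof -
      let ?h = "\<lambda>i. (?a - int i, 0, ?b + ?c + 1 + int i)"
      let ?g = "\<lambda>(p, q, r). scale (delta_10_2 (?a - p) (?b - q) (?c - r)) (Y_iter Y u v w p q r)"
      have "Sum_any ?g = (\<Sum>j<K. ?g (?h j))"
      proof (rule Sum_any_along_injection)
        show "?g t = 0" if t: "t \<notin> ?h ` {..<K}" for t
        proof (rule ccontr)
          obtain p q r where pqr: "t = (p, q, r)" by (cases t)
          assume nz: "?g t \<noteq> 0"
          hence d: "delta_10_2 (?a - p) (?b - q) (?c - r) \<noteq> (0::'k)" and Yp: "Y_iter Y u v w p q r \<noteq> 0"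
            using pqr by auto
          define i where "i = nat (?a - p)"
          have q: "q = 0" using Yp by (auto simp: Y_iter_def split: if_splits)
          have p: "p = ?a - int i" and r: "r = ?b + ?c + 1 + int i"
            using d q by (auto simp: delta_10_2_def binom_minus_def i_def split: if_splits)
          have "i < K"
          proof (rule ccontr)
            assume "\<not> i < K"
            hence "Y u (l + int i) v = 0" using K by auto
            thus False using Yp p q by (auto simp: Y_iter_def algebra_simps)
          qed
          thus False using t p q r pqr by auto
        qed
      qed (auto simp: inj_def)
      also have "\<dots> = (\<Sum>i<K. scale (of_int m gchoose i) (Y (Y u (l + int i) v) (m + n - int i) w))"
      proof (rule sum.cong[OF refl])
        fix i
        have "(of_int m gchoose i) = (-1) ^ i * (of_int (int i - m - 1) gchoose i :: 'k)"
          by (subst gbinomial_negated_upper) simp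
        thus "?g (?h i) = scale (of_int m gchoose i) (Y (Y u (l + int i) v) (m + n - int i) w)"
          by (simp add: delta_10_2_def binom_minus_def Y_iter_def algebra_simps)
      qed
      finally show ?thesis unfolding series3_mult_def .
    qed
    show ?thesis
      using jacobi[of u v w ?a ?b ?c] unfolding 1 2 3 .
  qed
  thus ?thesis by blast
qed

text \<open>
  The case \<open>l = 0\<close> of the Borcherds identity, where only the summand \<open>j = 0\<close> survives on the left.
\<close>

lemma commutator_formula:
  "\<exists>K. Y u m (Y v n w) - Y v n (Y u m w)
    = (\<Sum>i<K. scale (of_int m gchoose i) (Y (Y u (int i) v) (m + n - int i) w))"
proof -
  have zero: "(0 gchoose j) = (if j = 0 then 1 else 0 :: 'k)" for j
    by (cases j) auto
  obtain K0 where K0: "\<forall>K\<ge>K0.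
    (\<Sum>j<K. scale ((-1) ^ j * (of_int 0 gchoose j)) (Y u (0 + m - int j) (Y v (n + int j) w)))
    - (\<Sum>j<K. scale ((-1) powi 0 * ((-1) ^ j * (of_int 0 gchoose j)))
          (Y v (0 + n - int j) (Y u (m + int j) w)))
    = (\<Sum>i<K. scale (of_int m gchoose i) (Y (Y u (0 + int i) v) (m + n - int i) w))"
    using borcherds[of 0 u m v n w] by blast
  have single: "(\<Sum>j<Suc K0. scale (c j * (of_int 0 gchoose j)) (g j)) = scale (c 0) (g 0)"
    for g :: "nat \<Rightarrow> 'v" and c
    by (subst sum.lessThan_Suc_shift) (simp add: zero)
  show ?thesis
    using K0[rule_format, of "Suc K0"]
    by (intro exI[of _ "Suc K0"]) (simp only: single mult.assoc[symmetric], simp)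
qed

text \<open>
  The case \<open>m = 0\<close> of the Borcherds identity, where only the summand \<open>i = 0\<close> survives on the right.
\<close>

lemma iterate_formula:
  "\<exists>K0. \<forall>K\<ge>K0. Y (Y u l v) n w
    = (\<Sum>j<K. scale ((-1) ^ j * (of_int l gchoose j)) (Y u (l - int j) (Y v (n + int j) w)))
    - (\<Sum>j<K. scale ((-1) powi l * ((-1) ^ j * (of_int l gchoose j)))
          (Y v (l + n - int j) (Y u (int j) w)))"
proof -
  have zero: "(0 gchoose j) = (if j = 0 then 1 else 0 :: 'k)" for j
    by (cases j) auto
  have single: "(\<Sum>i<Suc K. scale (of_int 0 gchoose i) (g i)) = g 0" for g :: "nat \<Rightarrow> 'v" and K
    by (subst sum.lessThan_Suc_shift) (simp add: zero)
  obtain K0 where K0: "\<forall>K\<ge>K0.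
    (\<Sum>j<K. scale ((-1) ^ j * (of_int l gchoose j)) (Y u (l + 0 - int j) (Y v (n + int j) w)))
    - (\<Sum>j<K. scale ((-1) powi l * ((-1) ^ j * (of_int l gchoose j)))
          (Y v (l + n - int j) (Y u (0 + int j) w)))
    = (\<Sum>i<K. scale (of_int 0 gchoose i) (Y (Y u (l + int i) v) (0 + n - int i) w))"
    using borcherds[of l u 0 v n w] by blast
  show ?thesis
  proof (intro exI[of _ "Suc K0"] allI impI)
    fix K assume "Suc K0 \<le> K"
    then obtain K' where K': "K = Suc K'" "K0 \<le> K" by (cases K) auto
    show "Y (Y u l v) n w
    = (\<Sum>j<K. scale ((-1) ^ j * (of_int l gchoose j)) (Y u (l - int j) (Y v (n + int j) w)))
    - (\<Sum>j<K. scale ((-1) powi l * ((-1) ^ j * (of_int l gchoose j)))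
          (Y v (l + n - int j) (Y u (int j) w)))"
      using K0[rule_format, OF K'(2)] single[where K = K'] K'(1) by (simp del: sum.lessThan_Suc)
  qed
qed

section \<open>Homogeneous components and degrees of modes\<close>

definition component :: "'v \<Rightarrow> int \<Rightarrow> 'v" where
  "component v = (THE f. finite {n. f n \<noteq> 0} \<and> (\<forall>n. f n \<in> V n) \<and> v = (\<Sum>n | f n \<noteq> 0. f n))"

lemma component_decomposition:
  "finite {n. component v n \<noteq> 0}" "component v n \<in> V n"
  "v = (\<Sum>n | component v n \<noteq> 0. component v n)"
  using theI'[OF grading_direct_sum[of v], folded component_def] by blast+

lemma zero_in_V [simp]: "0 \<in> V n"
  using grading_subspace by (rule subspace_0)

lemma component_eqI:
  assumes "finite A" "\<And>n. f n \<in> V n" "\<And>n. n \<notin> A \<Longrightarrow> f n = 0" "v = sum f A"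
  shows "component v = f"
proof -
  have sub: "{n. f n \<noteq> 0} \<subseteq> A" using assms(3) by blast
  have "sum f A = (\<Sum>n | f n \<noteq> 0. f n)"
    using assms(1) sub by (intro sum.mono_neutral_right) auto
  hence "finite {n. f n \<noteq> 0} \<and> (\<forall>n. f n \<in> V n) \<and> v = (\<Sum>n | f n \<noteq> 0. f n)"
    using assms sub finite_subset by auto
  thus ?thesis
    unfolding component_def by (rule the1_equality[OF grading_direct_sum])
qed

lemma sum_components:
  "finite A \<Longrightarrow> {n. component v n \<noteq> 0} \<subseteq> A \<Longrightarrow> sum (component v) A = v"
  by (subst (2) component_decomposition(3), rule sum.mono_neutral_right) auto

lemma component_add: "component (v + w) = (\<lambda>n. component v n + component w n)"
proof (rule component_eqI)
  let ?A = "{n. component v n \<noteq> 0} \<union> {n. component w n \<noteq> 0}"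
  show fin: "finite ?A" by (simp add: component_decomposition)
  show "v + w = (\<Sum>n\<in>?A. component v n + component w n)"
    unfolding sum.distrib
    by (subst (1 2) sum_components) (use fin in auto)
qed (auto intro: subspace_add grading_subspace component_decomposition)

lemma component_scale: "component (scale c v) = (\<lambda>n. scale c (component v n))"
proof (rule component_eqI)
  let ?A = "{n. component v n \<noteq> 0}"
  show "scale c v = (\<Sum>n\<in>?A. scale c (component v n))"
    using component_decomposition(3)[of v] by (metis scale_sum_right)
qed (auto intro: subspace_scale grading_subspace component_decomposition)

lemma component_homogeneous:
  "v \<in> V d \<Longrightarrow> component v = (\<lambda>n. if n = d then v else 0)"
  by (rule component_eqI[of "{d}"]) auto

lemma degree_unique:
  assumes "v \<in> V d" "v \<in> V e" "v \<noteq> 0"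
  shows "d = e"
  using component_homogeneous[OF assms(1)] component_homogeneous[OF assms(2)] assms(3) by metis

lemma span_homogeneous: "span {v. homogeneous V v} = UNIV"
proof -
  have "v \<in> span {v. homogeneous V v}" for v
  proof (subst component_decomposition(3), rule span_sum)
    show "component v n \<in> span {v. homogeneous V v}" for n
      by (rule span_base) (auto simp: homogeneous_def intro: component_decomposition)
  qed
  thus ?thesis by blast
qed

text \<open>
  The projection to degree \<open>d\<close> maps each homogeneous element of \<open>S\<close> to itself or to zero. This keeps
  degrees under control when a homogeneous letter is expanded in a spanning set.
\<close>

lemma span_homogeneous_degree:
  assumes hom: "\<And>s. s \<in> S \<Longrightarrow> homogeneous V s" and u: "u \<in> span S" "u \<in> V d"
  shows "u \<in> span (S \<inter> V d)"
proof -
  have "component v d \<in> span (S \<inter> V d)" if "v \<in> span S" for v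
    using that
  proof (induction rule: span_induct)
    case base
    show ?case
      using component_homogeneous[of 0 0]
      by (auto simp: subspace_def component_add component_scale span_add span_scale span_zero fun_eq_iff)
  next
    case (step s)
    then obtain e where "s \<in> V e" using hom by (auto simp: homogeneous_def)
    thus ?case using step by (auto simp: component_homogeneous span_zero intro: span_base)
  qed
  thus ?thesis using u component_homogeneous[OF u(2)] by metis
qed

text \<open>
  In characteristic zero the eigenvalues of \<open>L 0\<close> on different degrees are different, so all
  components of an eigenvector outside one degree vanish.
\<close>

lemma L0_eigenvector_degree:
  assumes "L 0 x = scale (of_int d) x"
  shows "x \<in> V d"
proof -
  let ?A = "{n. component x n \<noteq> 0}"
  have L0_sum: "L 0 (sum f B) = (\<Sum>b\<in>B. L 0 (f b))" if "finite B" for f and B :: "int set"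
    using that L_linear[of 0]
    by (induction B rule: finite_induct) (auto simp: Vector_Spaces.linear_iff L0_weight[of 0 0])
  have "L 0 x = (\<Sum>n\<in>?A. L 0 (component x n))"
    using component_decomposition(3)[of x] component_decomposition(1)[of x] L0_sum by metis
  also have "\<dots> = (\<Sum>n\<in>?A. scale (of_int n) (component x n))"
    by (intro sum.cong refl L0_weight component_decomposition)
  finally have "component (L 0 x) = (\<lambda>n. scale (of_int n) (component x n))"
    by (intro component_eqI[of ?A])
       (auto intro: component_decomposition subspace_scale grading_subspace)
  hence "scale (of_int n) (component x n) = scale (of_int d) (component x n)" for n
    using assms by (metis component_scale)
  hence "component x n = 0" if "n \<noteq> d" for n
    using that by (metis of_int_eq_iff scale_cancel_right)
  hence "sum (component x) {d} = x" by (intro sum_components) auto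
  thus ?thesis using component_decomposition(2)[of x d] by simp
qed

text \<open>
  The commutator of \<open>L 0\<close> with \<open>Y u n\<close> together with the derivative rule shows that \<open>Y u n v\<close> is an
  eigenvector of \<open>L 0\<close> with eigenvalue \<open>d + e - n - 1\<close>.
\<close>

lemma mode_degree:
  assumes "u \<in> V d" "v \<in> V e"
  shows "Y u n v \<in> V (d + e - n - 1)"
proof (rule L0_eigenvector_degree)
  have range: "{0..nat (0 + 1)} = {0, 1 :: nat}" by auto
  have "L 0 (Y u n v) - Y u n (L 0 v) = Y (L (- 1) u) (n + 1) v + Y (L 0 u) n v"
    using L_Y_commutator[of 0 u n v] unfolding range by simp
  also have "Y (L (- 1) u) (n + 1) v = scale (of_int (- (n + 1))) (Y u n v)"
    using L_derivative[of "n + 1" u v] by simp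
  also have "Y (L 0 u) n v = scale (of_int d) (Y u n v)"
    using L0_weight[OF assms(1)] by (simp add: Y_scale_left)
  also have "Y u n (L 0 v) = scale (of_int e) (Y u n v)"
    using L0_weight[OF assms(2)] by (simp add: Y_scale_right)
  finally have "L 0 (Y u n v) = scale (of_int (- (n + 1)) + of_int d + of_int e) (Y u n v)"
    by (simp only: scale_left_distrib) (simp add: algebra_simps)
  thus "L 0 (Y u n v) = scale (of_int (d + e - n - 1)) (Y u n v)"
    by (simp add: algebra_simps)
qed

end

section \<open>The filtration by cost\<close>

locale cost_filtration = moebius_vertex_algebra scale V Y vac L
  for scale :: "'k::field_char_0 \<Rightarrow> 'v::ab_group_add \<Rightarrow> 'v" and V Y vac L +
  fixes N :: nat
  assumes N_graded: "N_graded V" and N_pos: "N > 0"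
begin

abbreviation word :: "('v \<times> int) list \<Rightarrow> 'v" where
  "word \<equiv> mode_word Y vac"

abbreviation homs :: "('v \<times> int) list \<Rightarrow> bool" where
  "homs ps \<equiv> \<forall>p\<in>set ps. homogeneous V (fst p)"

text \<open>
  Only the zero vector lies in several degrees. The least natural degree assigns it weight zero, and makes
  \<open>weight u \<le> w\<close> valid for every \<open>u\<close> in \<open>V (int w)\<close>.
\<close>

definition weight :: "'v \<Rightarrow> nat" where
  "weight u = (LEAST w. u \<in> V (int w))"

definition cost :: "'v \<Rightarrow> nat" where
  "cost u = 2 * weight u + 2 * N - 1"

definition word_cost :: "('v \<times> int) list \<Rightarrow> nat" where
  "word_cost ps = (\<Sum>p\<leftarrow>ps. cost (fst p))"

text \<open>
  The bound is strict, so that \<open>below (word_cost ps)\<close> consists of what can be neglected next to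
  \<open>word ps\<close>, and \<open>below 0\<close> is the zero space.
\<close>

definition below :: "nat \<Rightarrow> 'v set" where
  "below q = span {word ps | ps. homs ps \<and> word_cost ps < q}"

lemma word_simps [simp]: "word [] = vac" "word ((u, n) # ps) = Y u n (word ps)"
  by (simp_all add: mode_word_def)

lemma word_cost_simps [simp]:
  "word_cost [] = 0" "word_cost (p # ps) = cost (fst p) + word_cost ps"
  "word_cost (ps @ qs) = word_cost ps + word_cost qs"
  by (simp_all add: word_cost_def)

lemma negative_degree: "u \<in> V d \<Longrightarrow> d < 0 \<Longrightarrow> u = 0"
  using N_graded by (auto simp: N_graded_def)

lemma weight_in: "homogeneous V u \<Longrightarrow> u \<in> V (int (weight u))"
proof -
  assume "homogeneous V u"
  then obtain d where d: "u \<in> V d" by (auto simp: homogeneous_def)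
  have "\<exists>w. u \<in> V (int w)"
  proof (cases "d < 0")
    case True
    thus ?thesis using negative_degree[OF d] by auto
  next
    case False
    thus ?thesis using d by (intro exI[of _ "nat d"]) auto
  qed
  thus ?thesis unfolding weight_def by (rule LeastI_ex)
qed

lemma weight_le: "u \<in> V (int w) \<Longrightarrow> weight u \<le> w"
  unfolding weight_def by (rule Least_le)

lemma subspace_below: "subspace (below q)"
  by (simp add: below_def)

lemmas below_add = subspace_add[OF subspace_below]
  and below_diff = subspace_diff[OF subspace_below]
  and below_scale = subspace_scale[OF subspace_below]
  and below_sum = subspace_sum[OF subspace_below]
  and below_zero [simp] = subspace_0[OF subspace_below]

lemma below_mono: "q \<le> r \<Longrightarrow> below q \<subseteq> below r"
  unfolding below_def by (rule span_mono) auto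

lemma word_below: "homs ps \<Longrightarrow> word_cost ps < q \<Longrightarrow> word ps \<in> below q"
  unfolding below_def by (rule span_base) auto

text \<open>
  The degree is an integer because letters such as \<open>u\<^sub>i v\<close> with large \<open>i\<close> have formally negative
  degree; they are zero, and so are their modes.
\<close>

lemma mode_below:
  assumes u: "u \<in> V d" and x: "x \<in> below q"
    and bound: "int q + 2 * d + 2 * int N - 1 \<le> int r"
  shows "Y u n x \<in> below r"
proof (cases "u = 0")
  case False
  hence d: "d = int (nat d)" using negative_degree[OF u] by fastforce
  hence w: "weight u \<le> nat d" using u weight_le by metis
  have hom: "homogeneous V u" using u by (auto simp: homogeneous_def)
  have "{word ps | ps. homs ps \<and> word_cost ps < q} \<subseteq> {x. Y u n x \<in> below r}"
  proof clarify
    fix ps assume ps: "homs ps" "word_cost ps < q"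
    have "cost u + word_cost ps < r"
      using bound ps(2) w d N_pos unfolding cost_def by linarith
    thus "Y u n (word ps) \<in> below r"
      using word_below[of "(u, n) # ps" r] ps(1) hom by simp
  qed
  hence "below q \<subseteq> {x. Y u n x \<in> below r}"
    unfolding below_def[of q]
    by (intro span_minimal subspace_Collect_Y_right subspace_below)
  thus ?thesis using x by blast
qed simp

lemma letter_below:
  assumes "homogeneous V u" "x \<in> below q"
  shows "Y u n x \<in> below (cost u + q)"
  using N_pos by (intro mode_below[OF weight_in[OF assms(1)] assms(2)]) (simp add: cost_def)

text \<open>
  The commutator is a combination of modes of \<open>u\<^sub>i v\<close> with \<open>i \<ge> 0\<close>. Merging the two letters saves \<open>2 N - 1\<close>,
  and the weight of the merged letter is smaller than the sum of the two weights.
\<close>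

lemma commutator_below:
  assumes u: "homogeneous V u" and v: "homogeneous V v" and ps: "homs ps"
  shows "Y u m (Y v n (word ps)) - Y v n (Y u m (word ps))
    \<in> below (cost u + cost v + word_cost ps)"
proof -
  have "Y (Y u (int i) v) k (word ps) \<in> below (cost u + cost v + word_cost ps)" for i k
  proof (rule mode_below)
    show "Y u (int i) v \<in> V (int (weight u) + int (weight v) - int i - 1)"
      by (rule mode_degree[OF weight_in[OF u] weight_in[OF v]])
    show "word ps \<in> below (Suc (word_cost ps))" using ps by (rule word_below) simp
  qed (use N_pos in \<open>simp add: cost_def\<close>)
  thus ?thesis
    using commutator_formula[of u m v n "word ps"]
    by (auto intro!: below_sum below_scale)
qed

text \<open>
  The mode moves to the right through the word, at the price of commutators, and kills the vacuum.
\<close>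

lemma nonnegative_mode_below:
  assumes u: "homogeneous V u" and ps: "homs ps" and n: "0 \<le> n"
  shows "Y u n (word ps) \<in> below (cost u + word_cost ps)"
  using ps
proof (induction ps)
  case Nil
  show ?case using creation_regular[OF n] by simp
next
  case (Cons p ps)
  obtain v m where p: "p = (v, m)" by (cases p)
  have v: "homogeneous V v" and ps: "homs ps" using Cons.prems p by auto
  have "Y v m (Y u n (word ps)) \<in> below (cost v + (cost u + word_cost ps))"
    using letter_below[OF v Cons.IH[OF ps]] .
  hence "(Y u n (Y v m (word ps)) - Y v m (Y u n (word ps))) + Y v m (Y u n (word ps))
      \<in> below (cost u + cost v + word_cost ps)"
    using commutator_below[OF u v ps] by (intro below_add) (simp_all add: ac_simps)
  thus ?case using p by (simp add: ac_simps)
qed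

text \<open>
  Each exchange of neighbours costs a commutator; it suffices to move single letters to the front.
\<close>

lemma word_permute:
  "mset ps = mset qs \<Longrightarrow> homs ps \<Longrightarrow> word ps - word qs \<in> below (word_cost ps)"
proof (induction ps arbitrary: qs)
  case (Cons p ps)
  obtain u n where p: "p = (u, n)" by (cases p)
  have "set (p # ps) = set qs" using Cons.prems(1) by (rule mset_eq_setD)
  hence "p \<in> set qs" by auto
  then obtain q1 q2 where qs: "qs = q1 @ p # q2" by (meson split_list)
  have u: "homogeneous V u" and ps: "homs ps" using Cons.prems p by auto
  have m: "mset ps = mset (q1 @ q2)" using Cons.prems(1) qs by simp
  \<comment> \<open>Moving the letter \<open>p\<close> to the front of \<open>r @ p # q2\<close>.\<close>
  have move: "Y u n (word (r @ q2)) - word (r @ p # q2) \<in> below (cost u + word_cost (r @ q2))"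
    if "homs (r @ q2)" for r
    using that
  proof (induction r)
    case (Cons r rs)
    obtain v k where r: "r = (v, k)" by (cases r)
    have v: "homogeneous V v" and rs: "homs (rs @ q2)" using Cons.prems r by auto
    have "Y v k (Y u n (word (rs @ q2)) - word (rs @ p # q2))
       \<in> below (cost v + (cost u + word_cost (rs @ q2)))"
      by (rule letter_below[OF v Cons.IH[OF rs]])
    hence "(Y u n (Y v k (word (rs @ q2))) - Y v k (Y u n (word (rs @ q2))))
       + Y v k (Y u n (word (rs @ q2)) - word (rs @ p # q2))
       \<in> below (cost u + cost v + word_cost (rs @ q2))"
      using commutator_below[OF u v rs] by (intro below_add) (simp_all add: ac_simps)
    thus ?case using r by (simp add: Y_diff_right ac_simps)
  qed (simp add: p)
  have "mset (map (\<lambda>p. cost (fst p)) ps) = mset (map (\<lambda>p. cost (fst p)) (q1 @ q2))"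
    unfolding mset_map m ..
  hence c: "word_cost ps = word_cost (q1 @ q2)"
    unfolding word_cost_def by (metis sum_mset_sum_list)
  have h: "homs (q1 @ q2)" using ps unfolding mset_eq_setD[OF m] .
  have "Y u n (word ps - word (q1 @ q2)) \<in> below (cost u + word_cost ps)"
    by (rule letter_below[OF u Cons.IH[OF m ps]])
  hence "Y u n (word ps - word (q1 @ q2)) + (Y u n (word (q1 @ q2)) - word qs)
     \<in> below (cost u + word_cost ps)"
    using move[OF h] unfolding c qs by (intro below_add)
  thus ?case using p by (simp add: Y_diff_right)
qed simp

lemma two_letters_below:
  assumes u: "homogeneous V u" and v: "homogeneous V v" and x: "x \<in> below q"
  shows "Y u m (Y v n x) \<in> below (cost u + cost v + q)"
  using letter_below[OF u letter_below[OF v x]] by (simp add: ac_simps)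

text \<open>
  Apply the iterate formula to \<open>Y (Y u l v) n\<close> with \<open>l = - 1 - j\<close> and \<open>n = s - l\<close>. The left-hand side has small
  cost since its two letters are merged into one of weight \<open>wt u + wt v + j\<close>. On the right, all
  summands with a nonnegative mode have small cost. The others are \<open>u\<^sub>a v\<^sub>b\<close> with \<open>a = l - i\<close>, and their
  coefficient is \<open>(i + j choose j) = (- a - 1 choose j)\<close>. This binomial is zero for \<open>l < a < 0\<close>, so
  the sum may run over all pairs of negative modes, independently of \<open>j\<close>.
\<close>

lemma iterate_relation:
  assumes u: "homogeneous V u" and v: "homogeneous V v" and ps: "homs ps" and j: "j < N"
  shows "(\<Sum>a | s < a \<and> a < 0.
      scale (of_nat (nat (- a - 1) choose j)) (Y u a (Y v (s - a) (word ps))))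
    \<in> below (cost u + cost v + word_cost ps)"
proof -
  let ?B = "below (cost u + cost v + word_cost ps)"
  define l where "l = - 1 - int j"
  define n where "n = s - l"
  define g where "g i = scale ((-1) ^ i * (of_int l gchoose i)) (Y u (l - int i) (Y v (n + int i) (word ps)))" for i
  define h where "h i = scale ((-1) powi l * ((-1) ^ i * (of_int l gchoose i)))
          (Y v (l + n - int i) (Y u (int i) (word ps)))" for i
  define t where "t a = scale (of_nat (nat (- a - 1) choose j)) (Y u a (Y v (s - a) (word ps)))" for a
  obtain K0 where K0: "\<forall>K\<ge>K0. Y (Y u l v) n (word ps) = sum g {..<K} - sum h {..<K}"
    using iterate_formula[of u l v n "word ps"] unfolding g_def h_def by blast
  \<comment> \<open>The cutoff \<open>- n\<close> ensures that every \<open>i\<close> with \<open>n + i < 0\<close> occurs in the sums.\<close>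
  define K where "K = max K0 (nat (- n))"
  have "Y (Y u l v) n (word ps) \<in> ?B"
  proof (rule mode_below)
    show "Y u l v \<in> V (int (weight u) + int (weight v) - l - 1)"
      by (rule mode_degree[OF weight_in[OF u] weight_in[OF v]])
    show "word ps \<in> below (Suc (word_cost ps))" using ps by (rule word_below) simp
  qed (use j in \<open>simp add: cost_def l_def\<close>)
  moreover have "h i \<in> ?B" for i
    using letter_below[OF v nonnegative_mode_below[OF u ps, of "int i"], of "l + n - int i"]
    unfolding h_def by (intro below_scale) (simp add: ac_simps)
  ultimately have "Y (Y u l v) n (word ps) + sum h {..<K} \<in> ?B"
    by (intro below_add below_sum)
  hence g_all: "sum g {..<K} \<in> ?B" using K0[rule_format, of K] by (simp add: K_def)
  let ?I = "{i \<in> {..<K}. n + int i < 0}"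
  have "g i \<in> ?B" if "\<not> n + int i < 0" for i
    using letter_below[OF u nonnegative_mode_below[OF v ps, of "n + int i"], of "l - int i"] that
    unfolding g_def by (intro below_scale) (simp add: ac_simps)
  hence "sum g {..<K} - sum g {i \<in> {..<K}. \<not> n + int i < 0} \<in> ?B"
    by (intro below_diff g_all below_sum) auto
  also have "sum g {..<K} - sum g {i \<in> {..<K}. \<not> n + int i < 0} = sum g ?I"
  proof -
    have "sum g {..<K} = sum g (?I \<union> {i \<in> {..<K}. \<not> n + int i < 0})"
      by (rule arg_cong[where f = "sum g"]) auto
    also have "\<dots> = sum g ?I + sum g {i \<in> {..<K}. \<not> n + int i < 0}"
      by (rule sum.union_disjoint) auto
    finally show ?thesis by simp
  qed
  also have "sum g ?I = (\<Sum>i\<in>?I. t (l - int i))"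
  proof (rule sum.cong[OF refl])
    fix i
    have "(of_int l gchoose i) = (-1) ^ i * ((1 + of_nat j + of_nat i - 1) gchoose i :: 'k)"
      using gbinomial_minus[of "1 + of_nat j :: 'k" i] by (simp add: l_def)
    also have "(1 + of_nat j + of_nat i - 1) gchoose i = (of_nat (i + j choose j) :: 'k)"
      using binomial_symmetric[of j "i + j"] by (simp add: binomial_gbinomial add.commute)
    finally have "(-1) ^ i * (of_int l gchoose i) = (of_nat (i + j choose j) :: 'k)"
      by simp
    moreover have "nat (- (l - int i) - 1) = i + j" "s - (l - int i) = n + int i"
      by (auto simp: l_def n_def)
    ultimately show "g i = t (l - int i)" unfolding g_def t_def by (simp only:)
  qed
  also have "\<dots> = sum t ((\<lambda>i. l - int i) ` ?I)"
    by (subst sum.reindex) (auto simp: inj_on_def)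
  also have "\<dots> = sum t {a. s < a \<and> a < 0}"
  proof (rule sum.mono_neutral_left)
    have "{a. s < a \<and> a < 0} = {s<..<0}" by auto
    thus "finite {a. s < a \<and> a < 0}" by simp
    show "(\<lambda>i. l - int i) ` ?I \<subseteq> {a. s < a \<and> a < 0}" by (auto simp: l_def n_def)
    show "\<forall>a\<in>{a. s < a \<and> a < 0} - (\<lambda>i. l - int i) ` ?I. t a = 0"
    proof
      fix a assume a: "a \<in> {a. s < a \<and> a < 0} - (\<lambda>i. l - int i) ` ?I"
      have "l < a"
      proof (rule ccontr)
        assume "\<not> l < a"
        hence "a = l - int (nat (l - a))" "nat (l - a) \<in> ?I"
          using a by (auto simp: K_def n_def)
        thus False using a by blast
      qed
      hence "nat (- a - 1) < j" using a by (auto simp: l_def)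
      thus "t a = 0" by (simp add: t_def)
    qed
  qed
  finally show ?thesis unfolding t_def .
qed

text \<open>
  The coefficients of the relations above, as functions of \<open>- a - 1\<close>, span the polynomials of degree less than \<open>N\<close>.
  Interpolation at the close pairs isolates the pair at \<open>a0\<close>, and what remains are spread pairs.
\<close>

lemma close_pair_in_subspace:
  assumes u: "homogeneous V u" and v: "homogeneous V v" and ps: "homs ps"
    and a0: "s < a0" "a0 < 0" "\<bar>2 * a0 - s\<bar> < int N"
    and A: "subspace A" "below (cost u + cost v + word_cost ps) \<subseteq> A"
    and spread: "\<And>a. s < a \<Longrightarrow> a < 0 \<Longrightarrow> int N \<le> \<bar>2 * a - s\<bar> \<Longrightarrow>
      Y u a (Y v (s - a) (word ps)) \<in> A"
  shows "Y u a0 (Y v (s - a0) (word ps)) \<in> A"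
proof -
  let ?f = "\<lambda>a. Y u a (Y v (s - a) (word ps))"
  let ?R = "{a. s < a \<and> a < 0}"
  let ?M = "{a. s < a \<and> a < 0 \<and> \<bar>2 * a - s\<bar> < int N}"
  \<comment> \<open>The interpolation nodes; \<open>- a - 1\<close> is a natural number for each negative mode \<open>a\<close>.\<close>
  let ?T = "(\<lambda>a. nat (- a - 1)) ` ?M"
  have "?R = {s<..<0}" by auto
  hence finR: "finite ?R" by simp
  hence finM: "finite ?M" by (rule finite_subset[rotated]) auto
  have "card ?T \<le> N"
    using card_image_le[OF finM, of "\<lambda>a. nat (- a - 1)"] card_close_pairs[of s N] by linarith
  then obtain c :: "nat \<Rightarrow> 'k" where
    c: "\<forall>t\<in>?T. (\<Sum>j<N. c j * of_nat (t choose j)) = (if t = nat (- a0 - 1) then 1 else 0)"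
    using binomial_interpolation[of ?T N "nat (- a0 - 1)"] finM a0 by auto
  define e where "e a = (\<Sum>j<N. c j * of_nat (nat (- a - 1) choose j))" for a
  have e: "e a = (if a = a0 then 1 else 0)" if "a \<in> ?M" for a
  proof -
    have "nat (- a - 1) = nat (- a0 - 1) \<longleftrightarrow> a = a0" using that a0 by auto
    thus ?thesis
      using c[rule_format, OF imageI[OF that]] unfolding e_def by (simp only:)
  qed
  have "(\<Sum>j<N. scale (c j) (\<Sum>a\<in>?R. scale (of_nat (nat (- a - 1) choose j)) (?f a))) \<in> A"
  proof (rule subspace_sum[OF A(1)], rule subspace_scale[OF A(1)])
    fix j assume "j \<in> {..<N}"
    thus "(\<Sum>a\<in>?R. scale (of_nat (nat (- a - 1) choose j)) (?f a)) \<in> A"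
      using iterate_relation[OF u v ps, of j s] A(2) by blast
  qed
  also have "(\<Sum>j<N. scale (c j) (\<Sum>a\<in>?R. scale (of_nat (nat (- a - 1) choose j)) (?f a)))
      = (\<Sum>a\<in>?R. scale (e a) (?f a))"
    unfolding e_def scale_sum_left scale_sum_right scale_scale by (rule sum.swap)
  also have "\<dots> = scale (e a0) (?f a0) + (\<Sum>a\<in>?R - {a0}. scale (e a) (?f a))"
    using finR a0 by (intro sum.remove) auto
  also have "e a0 = 1" using e a0 by simp
  finally have total: "?f a0 + (\<Sum>a\<in>?R - {a0}. scale (e a) (?f a)) \<in> A" by simp
  have "scale (e a) (?f a) \<in> A" if "a \<in> ?R - {a0}" for a
  proof (cases "\<bar>2 * a - s\<bar> < int N")
    case True
    thus ?thesis using e[of a] that subspace_0[OF A(1)] by simp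
  next
    case False
    thus ?thesis using that by (intro subspace_scale[OF A(1)] spread) auto
  qed
  hence "(\<Sum>a\<in>?R - {a0}. scale (e a) (?f a)) \<in> A" by (intro subspace_sum[OF A(1)])
  from subspace_diff[OF A(1) total this] show ?thesis by simp
qed

text \<open>
  The iterate formula splits the letter into \<open>p\<close> and \<open>q\<close>, whose weights add up to \<open>w - N\<close>. Losing weight
  \<open>N\<close> saves \<open>2 N\<close>, and the additional letter costs only \<open>2 N - 1\<close>.
\<close>

lemma zhu_letter_below:
  assumes p: "homogeneous V p" and q: "homogeneous V q" and ps: "homs ps"
    and nz: "Y p (- int (N + 1)) q \<noteq> 0" and w: "Y p (- int (N + 1)) q \<in> V (int w)"
  shows "Y (Y p (- int (N + 1)) q) n (word ps) \<in> below (2 * w + 2 * N - 1 + word_cost ps)"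
proof -
  have "Y p (- int (N + 1)) q \<in> V (int (weight p) + int (weight q) - (- int (N + 1)) - 1)"
    by (rule mode_degree[OF weight_in[OF p] weight_in[OF q]])
  hence w: "w = weight p + weight q + N" using degree_unique[OF w _ nz] by force
  have cost: "cost p + cost q + Suc (word_cost ps) = 2 * w + 2 * N - 1 + word_cost ps"
    using N_pos by (simp add: w cost_def)
  have x: "word ps \<in> below (Suc (word_cost ps))" using ps by (rule word_below) simp
  have "Y p k (Y q m (word ps)) \<in> below (2 * w + 2 * N - 1 + word_cost ps)"
    "Y q m (Y p k (word ps)) \<in> below (2 * w + 2 * N - 1 + word_cost ps)" for k m
    using two_letters_below[OF p q x] two_letters_below[OF q p x] unfolding cost[symmetric]
    by (simp_all add: ac_simps)
  moreover obtain K where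
    "Y (Y p (- int (N + 1)) q) n (word ps)
    = (\<Sum>j<K. scale ((-1) ^ j * (of_int (- int (N + 1)) gchoose j))
        (Y p (- int (N + 1) - int j) (Y q (n + int j) (word ps))))
    - (\<Sum>j<K. scale ((-1) powi (- int (N + 1)) * ((-1) ^ j * (of_int (- int (N + 1)) gchoose j)))
          (Y q (- int (N + 1) + n - int j) (Y p (int j) (word ps))))"
    using iterate_formula[of p "- int (N + 1)" q n "word ps"] by blast
  ultimately show ?thesis
    by (simp only:) (intro below_diff below_sum below_scale)
qed

end

section \<open>Reduction to letters from the spanning set\<close>

locale zhu_spanning_set = cost_filtration scale V Y vac L N
  for scale :: "'k::field_char_0 \<Rightarrow> 'v::ab_group_add \<Rightarrow> 'v" and V Y vac L N +
  fixes X :: "'v set"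
  assumes X_homogeneous: "\<forall>x\<in>X. homogeneous V x"
    and X_spans: "spans_quotient X (zhu_subspace Y (N + 1))"
begin

lemma span_X_and_zhu:
  "span (X \<union> {Y p (- int (N + 1)) q | p q. homogeneous V p \<and> homogeneous V q}) = UNIV"
  (is "span (X \<union> ?C) = UNIV")
proof -
  let ?Z = "zhu_subspace Y (N + 1)"
  let ?H = "{v. homogeneous V v}"
  have q: "Y p (- int (N + 1)) q \<in> span ?C" if p: "homogeneous V p" for p q
  proof -
    have "span ?H \<subseteq> {q. Y p (- int (N + 1)) q \<in> span ?C}"
    proof (intro span_minimal subspace_Collect_Y_right subspace_span subsetI CollectI)
      show "Y p (- int (N + 1)) q \<in> span ?C" if "q \<in> ?H" for q
        using p that by (intro span_base) blast
    qed
    thus ?thesis unfolding span_homogeneous by blast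
  qed
  have all: "Y p (- int (N + 1)) q \<in> span ?C" for p q
  proof -
    have "span ?H \<subseteq> {p. Y p (- int (N + 1)) q \<in> span ?C}"
      using q by (intro span_minimal subspace_Collect_Y_left subspace_span) blast
    thus ?thesis unfolding span_homogeneous by blast
  qed
  hence Z: "?Z \<subseteq> span ?C"
    unfolding zhu_subspace_def by (intro span_minimal subspace_span) blast
  have "v \<in> span (X \<union> ?C)" for v
  proof -
    have "coset_rel ?Z `` {v} \<in> UNIV // coset_rel ?Z" by (rule quotientI) simp
    hence "coset_rel ?Z `` {v} \<in> (\<lambda>x. coset_rel ?Z `` {x}) ` span X"
      using X_spans unfolding spans_quotient_def by (simp only:)
    then obtain x where x: "coset_rel ?Z `` {v} = coset_rel ?Z `` {x}" "x \<in> span X"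
      by (rule imageE)
    have "0 \<in> ?Z" unfolding zhu_subspace_def by (rule span_zero)
    hence "v \<in> coset_rel ?Z `` {v}" unfolding coset_rel_def by simp
    hence "v \<in> coset_rel ?Z `` {x}" by (simp only: x(1))
    hence "x - v \<in> ?Z" unfolding coset_rel_def by simp
    hence d: "x - v \<in> span (X \<union> ?C)"
      by (rule subsetD[OF order_trans[OF Z span_mono[OF Un_upper2]]])
    have "x \<in> span (X \<union> ?C)" by (rule subsetD[OF span_mono[OF Un_upper1] x(2)])
    from span_diff[OF this d] show ?thesis by simp
  qed
  thus ?thesis by blast
qed

text \<open>
  The letter \<open>u\<close> is a combination of elements of \<open>X\<close> and of elements \<open>p\<^sub>-\<^sub>N\<^sub>-\<^sub>1 q\<close>, all of which may be
  taken in the degree of \<open>u\<close>; the second kind contributes only smaller cost.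
\<close>

lemma first_letter_in_subspace:
  assumes u: "homogeneous V u" and ps: "homs ps"
    and T: "subspace T" "below (cost u + word_cost ps) \<subseteq> T"
    and letters: "\<And>x. x \<in> X \<Longrightarrow> cost x \<le> cost u \<Longrightarrow> Y x n (word ps) \<in> T"
  shows "Y u n (word ps) \<in> T"
proof -
  let ?C = "{Y p (- int (N + 1)) q | p q. homogeneous V p \<and> homogeneous V q}"
  let ?W = "V (int (weight u))"
  have "u \<in> span ((X \<union> ?C) \<inter> ?W)"
  proof (rule span_homogeneous_degree)
    show "homogeneous V s" if s: "s \<in> X \<union> ?C" for s
    proof (cases "s \<in> X")
      case False
      then obtain p q where "s = Y p (- int (N + 1)) q" "homogeneous V p" "homogeneous V q"
        using s by blast
      thus ?thesis using mode_degree unfolding homogeneous_def by blast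
    qed (use X_homogeneous in blast)
    show "u \<in> span (X \<union> ?C)" unfolding span_X_and_zhu by (rule UNIV_I)
  qed (rule weight_in[OF u])
  also have "\<dots> \<subseteq> {u'. Y u' n (word ps) \<in> T}"
  proof (intro span_minimal subspace_Collect_Y_left T(1) subsetI CollectI)
    fix s assume s: "s \<in> (X \<union> ?C) \<inter> ?W"
    show "Y s n (word ps) \<in> T"
    proof (cases "s \<in> X")
      case True
      have "weight s \<le> weight u" using s by (intro weight_le) blast
      hence "cost s \<le> cost u" unfolding cost_def by linarith
      thus ?thesis using True letters by blast
    next
      case False
      show ?thesis
      proof (cases "s = 0")
        case nz: False
        obtain p q where pq: "s = Y p (- int (N + 1)) q" "homogeneous V p" "homogeneous V q"
          using s False by blast
        have "Y s n (word ps) \<in> below (cost u + word_cost ps)"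
          unfolding cost_def pq(1) using s nz unfolding pq(1)
          by (intro zhu_letter_below[OF pq(2,3) ps]) blast+
        thus ?thesis using T(2) by blast
      qed (simp add: subspace_0[OF T(1)])
    qed
  qed
  finally show ?thesis by simp
qed

definition X_words :: "nat \<Rightarrow> 'v set" where
  "X_words q = {word qs | qs. fst ` set qs \<subseteq> X \<and> word_cost qs \<le> q}"

lemma homs_if_letters_in_X: "fst ` set qs \<subseteq> X \<Longrightarrow> homs qs"
  using X_homogeneous by auto

lemma word_in_span_X_words:
  "homs ps \<Longrightarrow> word ps \<in> span (X_words (word_cost ps) \<union> below (word_cost ps))"
proof (induction ps)
  case Nil
  have "word [] \<in> X_words 0" unfolding X_words_def by (rule CollectI, rule exI[of _ "[]"]) simp
  thus ?case by (auto intro: span_base)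
next
  case (Cons p ps)
  obtain u n where p: "p = (u, n)" by (cases p)
  have u: "homogeneous V u" and ps: "homs ps" using Cons.prems p by auto
  let ?T = "span (X_words (cost u + word_cost ps) \<union> below (cost u + word_cost ps))"
  have below_T: "below (cost u + word_cost ps) \<subseteq> ?T" by (auto intro: span_base)
  have "X_words (word_cost ps) \<union> below (word_cost ps) \<subseteq> {x. Y u n x \<in> ?T}"
  proof (intro subsetI CollectI)
    fix x assume x: "x \<in> X_words (word_cost ps) \<union> below (word_cost ps)"
    show "Y u n x \<in> ?T"
    proof (cases "x \<in> below (word_cost ps)")
      case True
      thus ?thesis using letter_below[OF u] below_T by blast
    next
      case False
      then obtain qs where qs: "x = word qs" "fst ` set qs \<subseteq> X" "word_cost qs \<le> word_cost ps"
        using x by (auto simp: X_words_def)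
      have "Y u n (word qs) \<in> ?T"
      proof (rule first_letter_in_subspace[OF u homs_if_letters_in_X[OF qs(2)]])
        show "below (cost u + word_cost qs) \<subseteq> ?T"
          using below_mono[of "cost u + word_cost qs" "cost u + word_cost ps"] qs(3) below_T by auto
        fix y assume "y \<in> X" "cost y \<le> cost u"
        hence "word ((y, n) # qs) \<in> X_words (cost u + word_cost ps)"
          unfolding X_words_def using qs
          by (intro CollectI exI[of _ "(y, n) # qs"]) auto
        thus "Y y n (word qs) \<in> ?T" by (auto intro: span_base)
      qed simp
      thus ?thesis using qs(1) by simp
    qed
  qed
  hence "span (X_words (word_cost ps) \<union> below (word_cost ps)) \<subseteq> {x. Y u n x \<in> ?T}"
    by (intro span_minimal subspace_Collect_Y_right) auto
  thus ?case using Cons.IH[OF ps] p by auto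
qed

section \<open>Spreading the modes apart\<close>

definition gap_span :: "'v set" where
  "gap_span = span {word ps | ps. admissible N X ps}"

lemma subspace_gap_span: "subspace gap_span"
  by (simp add: gap_span_def)

text \<open>
  As \<open>N > 0\<close>, gaps between neighbours already make the modes strictly increasing.
\<close>

lemma admissible_if_gaps:
  assumes X: "fst ` set ps \<subseteq> X" and neg: "\<forall>p\<in>set ps. snd p < 0"
    and gaps: "\<forall>i. Suc i < length ps \<longrightarrow> int N \<le> snd (ps ! Suc i) - snd (ps ! i)"
  shows "admissible N X ps"
proof -
  have "snd (ps ! i) < snd (ps ! Suc i)" if "Suc i < length ps" for i
    using gaps[rule_format, OF that] N_pos by linarith
  hence "sorted_wrt (<) (map snd ps)"
    by (subst sorted_wrt_iff_nth_Suc_transp) (auto simp: transp_def)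
  thus ?thesis using X neg gaps by (auto simp: admissible_def)
qed

text \<open>
  The distance of the sum of squares from its bound in \<open>sum_list_squares_le\<close>; it decreases when
  the modes move apart with their sum fixed.
\<close>

definition mode_spread :: "('v \<times> int) list \<Rightarrow> nat" where
  "mode_spread ps = nat ((\<Sum>p\<leftarrow>ps. snd p) * (\<Sum>p\<leftarrow>ps. snd p) - (\<Sum>p\<leftarrow>ps. snd p * snd p))"

text \<open>
  Modulo smaller cost the letters may be permuted at will. A word with a nonnegative mode is
  negligible. Otherwise sort by modes: if two neighbours are too close, move them to
  the front and replace them by spread pairs, which decreases \<open>mode_spread\<close>.
\<close>

lemma X_word_in_gap_span:
  assumes "fst ` set ps \<subseteq> X" "below (word_cost ps) \<subseteq> gap_span"
  shows "word ps \<in> gap_span"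
  using assms
proof (induction "mode_spread ps" arbitrary: ps rule: less_induct)
  case less
  note X = less.prems(1) and low = less.prems(2)
  have homs: "homs ps" by (rule homs_if_letters_in_X[OF X])
  have permuted: "word ps \<in> gap_span" if "word qs \<in> gap_span" "mset ps = mset qs" for qs
  proof -
    have "(word ps - word qs) + word qs \<in> gap_span"
      using word_permute[OF that(2) homs] low that(1)
      by (intro subspace_add[OF subspace_gap_span]) auto
    thus ?thesis by simp
  qed
  show ?case
  proof (cases "\<forall>p\<in>set ps. snd p < 0")
    case False
    then obtain u n where un: "(u, n) \<in> set ps" "0 \<le> n" by fastforce
    then obtain p1 p2 where ps: "ps = p1 @ (u, n) # p2" by (meson split_list)
    have "Y u n (word (p1 @ p2)) \<in> below (cost u + word_cost (p1 @ p2))"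
      using homs un(2) ps by (intro nonnegative_mode_below) auto
    also have "cost u + word_cost (p1 @ p2) = word_cost ps" by (simp add: ps)
    finally show ?thesis
      using low by (intro permuted[of "(u, n) # p1 @ p2"]) (auto simp: ps)
  next
    case neg: True
    define qs where "qs = sort_key snd ps"
    have mset: "mset ps = mset qs" and set: "set qs = set ps" by (simp_all add: qs_def)
    show ?thesis
    proof (cases "\<forall>i. Suc i < length qs \<longrightarrow> int N \<le> snd (qs ! Suc i) - snd (qs ! i)")
      case True
      hence "admissible N X qs" using X neg set by (intro admissible_if_gaps) auto
      hence "word qs \<in> gap_span" unfolding gap_span_def by (intro span_base) auto
      thus ?thesis using mset by (rule permuted)
    next
      case False
      then obtain i where i: "Suc i < length qs" "snd (qs ! Suc i) - snd (qs ! i) < int N"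
        by auto
      obtain u a where ua: "qs ! i = (u, a)" by (cases "qs ! i")
      obtain v b where vb: "qs ! Suc i = (v, b)" by (cases "qs ! Suc i")
      define rs where "rs = take i qs @ drop (Suc (Suc i)) qs"
      have "qs = take i qs @ (u, a) # (v, b) # drop (Suc (Suc i)) qs"
        using i(1) ua vb by (metis Cons_nth_drop_Suc Suc_lessD id_take_nth_drop)
      hence "mset qs = mset (take i qs @ (u, a) # (v, b) # drop (Suc (Suc i)) qs)"
        by (rule arg_cong)
      hence "mset qs = mset ((u, a) # (v, b) # rs)" by (simp add: rs_def)
      hence mset_rs: "mset ps = mset ((u, a) # (v, b) # rs)" using mset by simp
      hence set_rs: "set ps = set ((u, a) # (v, b) # rs)" by (rule mset_eq_setD)
      have sums: "sum_list (map f ps) = f (u, a) + f (v, b) + sum_list (map f rs)"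
        for f :: "'v \<times> int \<Rightarrow> 'c::comm_monoid_add"
      proof -
        have "mset (map f ps) = mset (map f ((u, a) # (v, b) # rs))"
          unfolding mset_map mset_rs ..
        hence "sum_list (map f ps) = sum_list (map f ((u, a) # (v, b) # rs))"
          by (metis sum_mset_sum_list)
        thus ?thesis by (simp add: add.assoc)
      qed
      have cost: "word_cost ps = cost u + cost v + word_cost rs"
        unfolding word_cost_def by (simp add: sums)
      have ab: "a < 0" "b < 0" using neg set_rs by auto
      have "a \<le> b"
        using sorted_nth_mono[of "map snd qs" i "Suc i"] i(1) ua vb by (simp add: qs_def)
      hence close: "\<bar>2 * a - (a + b)\<bar> < int N" using i(2) ua vb by simp
      have "Y u a (Y v (a + b - a) (word rs)) \<in> gap_span"
      proof (rule close_pair_in_subspace[OF _ _ _ _ ab(1) close subspace_gap_span])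
        show "below (cost u + cost v + word_cost rs) \<subseteq> gap_span" using low cost by simp
        fix a' assume a': "a + b < a'" "a' < 0" "int N \<le> \<bar>2 * a' - (a + b)\<bar>"
        let ?ps' = "(u, a') # (v, a + b - a') # rs"
        have sum_eq: "(\<Sum>p\<leftarrow>?ps'. snd p) = (\<Sum>p\<leftarrow>ps. snd p)"
          by (simp add: sums)
        \<comment> \<open>For a fixed sum, the sum of the two squares grows with the distance of the modes.\<close>
        have "\<bar>2 * a - (a + b)\<bar> < \<bar>2 * a' - (a + b)\<bar>" using a'(3) close by linarith
        hence "(2 * a - (a + b))\<^sup>2 < (2 * a' - (a + b))\<^sup>2" 
          using power_strict_mono[of _ _ 2] by (metis abs_ge_zero power2_abs zero_less_numeral)
        hence "a * a + b * b < a' * a' + (a + b - a') * (a + b - a')"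
          by (simp add: power2_eq_square algebra_simps)
        hence squares: "(\<Sum>p\<leftarrow>ps. snd p * snd p) < (\<Sum>p\<leftarrow>?ps'. snd p * snd p)"
          by (simp add: sums)
        have "\<forall>n\<in>set (map snd ?ps'). n < 0" using neg set_rs a' by auto
        from sum_list_squares_le[OF this]
        have "(\<Sum>p\<leftarrow>?ps'. snd p * snd p) \<le> (\<Sum>p\<leftarrow>ps. snd p) * (\<Sum>p\<leftarrow>ps. snd p)"
          unfolding sum_eq map_map comp_def .
        hence "mode_spread ?ps' < mode_spread ps"
          using squares unfolding mode_spread_def sum_eq by linarith
        moreover have "fst ` set ?ps' \<subseteq> X" using X set_rs by auto
        moreover have "below (word_cost ?ps') \<subseteq> gap_span" using low cost by (simp add: add.assoc)
        ultimately have "word ?ps' \<in> gap_span" by (rule less.hyps)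
        thus "Y u a' (Y v (a + b - a') (word rs)) \<in> gap_span" by simp
      qed (use homs set_rs ab in auto)
      thus ?thesis using mset_rs by (intro permuted[of "(u, a) # (v, b) # rs"]) auto
    qed
  qed
qed

lemma below_subset_gap_span: "below q \<subseteq> gap_span"
proof (induction q)
  case 0
  show ?case by (simp add: below_def subspace_0[OF subspace_gap_span])
next
  case (Suc q)
  show ?case
    unfolding below_def
  proof (intro span_minimal subspace_gap_span, clarify)
    fix ps assume ps: "homs ps" "word_cost ps < Suc q"
    hence low: "below (word_cost ps) \<subseteq> gap_span" using below_mono[of "word_cost ps" q] Suc.IH by simp
    have "X_words (word_cost ps) \<subseteq> gap_span"
      unfolding X_words_def using X_word_in_gap_span below_mono low by blast
    hence "span (X_words (word_cost ps) \<union> below (word_cost ps)) \<subseteq> gap_span"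
      using low by (intro span_minimal subspace_gap_span) auto
    thus "word ps \<in> gap_span" using word_in_span_X_words[OF ps(1)] by blast
  qed
qed

text \<open>
  Every homogeneous \<open>v\<close> is the one-letter word \<open>v\<^sub>-\<^sub>1 vac\<close>, by the creation property.
\<close>

theorem gap_span_UNIV: "gap_span = UNIV"
proof -
  have "v \<in> gap_span" if "homogeneous V v" for v
  proof -
    have "word [(v, - 1)] \<in> below (Suc (word_cost [(v, - 1)]))"
      using that by (intro word_below) auto
    thus ?thesis using below_subset_gap_span creation_limit by auto
  qed
  hence "span {v. homogeneous V v} \<subseteq> gap_span"
    by (intro span_minimal subspace_gap_span) auto
  thus ?thesis by (auto simp: span_homogeneous)
qed

end

theorem theorem5p1:
  fixes scale :: "'k::field_char_0 \<Rightarrow> 'v::ab_group_add \<Rightarrow> 'v"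
    and V :: "int \<Rightarrow> 'v set"
    and Y :: "'v \<Rightarrow> int \<Rightarrow> 'v \<Rightarrow> 'v"
    and vac :: 'v
    and L :: "int \<Rightarrow> 'v \<Rightarrow> 'v"
    and N :: nat
    and X :: "'v set"
  assumes "moebius_vertex_algebra scale V Y vac L"
    and "N_graded V"
    and "N > 0"
    and "\<forall>x\<in>X. homogeneous V x"
    and "vector_space.spans_quotient scale X (vector_space.zhu_subspace scale Y (N + 1))"
  shows "module.span scale {mode_word Y vac ps | ps. admissible N X ps} = UNIV"
proof -
  interpret moebius_vertex_algebra scale V Y vac L by (rule assms(1))
  interpret zhu_spanning_set scale V Y vac L N X
    by unfold_locales (use assms in auto)
  show ?thesis using gap_span_UNIV unfolding gap_span_def .
qed

end
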